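(* Let $(A,\cdot,\alpha,R)$ be a Rota-Baxter Hom-Lie-admissible algebra of weight $0$ such that $\alpha$ and $R$ commute. Define the binary operation $\ast$ on $A$ by $$x\ast y=R(x)\cdot y-y\cdot R(x)=[R(x),y].$$ Then $A_1=(A,\ast,\alpha)$ is a left Hom-preLie algebra.
   Context: $\mathbb{K}$ is a fixed field of characteristic $0$; all maps are $\mathbb{K}$-linear. A Hom-algebra $(A,\mu,\alpha)$ is a $\mathbb{K}$-module $A$ with a bilinear map $\mu\colon A\times A\to A$ and a linear map $\alpha\colon A\to A$ (not assumed multiplicative). The commutator bracket is $[x,y]=\mu(x,y)-\mu(y,x)$. A Hom-algebra $(A,\mu,\alpha)$ is Hom-Lie-admissible if its commutator bracket satisfies the Hom-Jacobi identity $[\alpha(x),[y,z]]+[\alpha(y),[z,x]]+[\alpha(z),[x,y]]=0$ for all $x,y,z\in A$. A Rota-Baxter Hom-Lie-admissible algebra of weight $\lambda\in\mathbb{K}$ is $(A,\cdot,\alpha,R)$ where $(A,\cdot,\alpha)$ is Hom-Lie-admissible and $R\colon A\to A$ is linear with $R(x)\cdot R(y)=R(R(x)\cdot y+x\cdot R(y)+\lambda x\cdot y)$ for all $x,y\in A$. A left Hom-preLie algebra is a Hom-algebra $(A,\mu,\alpha)$ satisfying $\mu(\alpha(x),\mu(y,z))-\mu(\alpha(y),\mu(x,z))=\mu(\mu(x,y),\alpha(z))-\mu(\mu(y,x),\alpha(z))$ for all $x,y,z\in A$. *)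

theory Defs
  imports Complex_Main
begin

text \<open>
  The underlying module of an algebra is a whole type \<open>'a\<close> of class \<open>ab_group_add\<close>, made into a
  vector space over the type \<open>'k\<close> by \<open>scale\<close>. Note that unqualified \<open>linear\<close> would mean
  linearity over the reals.
\<close>

locale hom_algebra = vector_space scale
  for scale :: "'k::field_char_0 \<Rightarrow> 'a::ab_group_add \<Rightarrow> 'a" +
  fixes mu :: "'a \<Rightarrow> 'a \<Rightarrow> 'a"
    and alpha :: "'a \<Rightarrow> 'a"
  assumes mu_linear_left: "Vector_Spaces.linear scale scale (\<lambda>x. mu x y)"
    and mu_linear_right: "Vector_Spaces.linear scale scale (\<lambda>y. mu x y)"
    and alpha_linear: "Vector_Spaces.linear scale scale alpha"

definition commutator_bracket :: "('a::ab_group_add \<Rightarrow> 'a \<Rightarrow> 'a) \<Rightarrow> 'a \<Rightarrow> 'a \<Rightarrow> 'a" where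
  "commutator_bracket mu x y = mu x y - mu y x"

locale hom_lie_admissible = hom_algebra scale mu alpha
  for scale :: "'k::field_char_0 \<Rightarrow> 'a::ab_group_add \<Rightarrow> 'a" and mu alpha +
  assumes hom_jacobi:
    "commutator_bracket mu (alpha x) (commutator_bracket mu y z)
     + commutator_bracket mu (alpha y) (commutator_bracket mu z x)
     + commutator_bracket mu (alpha z) (commutator_bracket mu x y) = 0"

locale rota_baxter_hom_lie_admissible = hom_lie_admissible scale mu alpha
  for scale :: "'k::field_char_0 \<Rightarrow> 'a::ab_group_add \<Rightarrow> 'a" and mu alpha +
  fixes R :: "'a \<Rightarrow> 'a"
    and weight :: 'k
  assumes R_linear: "Vector_Spaces.linear scale scale R"
    and rota_baxter: "mu (R x) (R y) = R (mu (R x) y + mu x (R y) + scale weight (mu x y))"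

locale left_hom_prelie = hom_algebra scale mu alpha
  for scale :: "'k::field_char_0 \<Rightarrow> 'a::ab_group_add \<Rightarrow> 'a" and mu alpha +
  assumes left_hom_prelie_identity:
    "mu (alpha x) (mu y z) - mu (alpha y) (mu x z)
     = mu (mu x y) (alpha z) - mu (mu y x) (alpha z)"

end

theory Submission
  imports Defs
begin

text \<open>
  Antisymmetrizing the Rota-Baxter identity of weight \<open>0\<close> gives
  \<open>[R x, R y] = R ([R x, y] - [R y, x])\<close>. Hence the right-hand side of the left Hom-preLie identity
  for \<open>x \<ast> y = [R x, y]\<close> is \<open>[[R x, R y], \<alpha> z]\<close>, and since \<open>\<alpha>\<close> commutes with \<open>R\<close> the identity is
  the Hom-Jacobi identity for \<open>R x\<close>, \<open>R y\<close>, \<open>z\<close>.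
\<close>

lemma commutator_bracket_minus_swap: "- commutator_bracket mu x y = commutator_bracket mu y x"
  by (simp add: commutator_bracket_def)

context hom_algebra
begin

text \<open>All linear maps here are endomorphisms, so the calculus of linear maps between two
  spaces is taken with \<open>scale\<close> on both sides.\<close>

sublocale pair: vector_space_pair scale scale ..

lemma commutator_bracket_linear_left:
  "Vector_Spaces.linear scale scale (\<lambda>x. commutator_bracket mu x y)"
  unfolding commutator_bracket_def
  by (intro pair.linear_compose_sub mu_linear_left mu_linear_right)

lemma commutator_bracket_linear_right:
  "Vector_Spaces.linear scale scale (\<lambda>y. commutator_bracket mu x y)"
  unfolding commutator_bracket_def
  by (intro pair.linear_compose_sub mu_linear_left mu_linear_right)

lemma commutator_bracket_diff_left:
  "commutator_bracket mu (x - y) z = commutator_bracket mu x z - commutator_bracket mu y z"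
  by (rule pair.linear_diff[OF commutator_bracket_linear_left])

lemma commutator_bracket_minus_right:
  "commutator_bracket mu x (- y) = - commutator_bracket mu x y"
  by (rule pair.linear_neg[OF commutator_bracket_linear_right])

end

context rota_baxter_hom_lie_admissible
begin

lemma R_diff: "R (x - y) = R x - R y"
  by (rule pair.linear_diff[OF R_linear])

lemma commutator_bracket_R_R:
  assumes "weight = 0"
  shows "commutator_bracket mu (R x) (R y)
    = R (commutator_bracket mu (R x) y - commutator_bracket mu (R y) x)"
proof -
  have "commutator_bracket mu (R x) (R y)
      = R ((mu (R x) y + mu x (R y)) - (mu (R y) x + mu y (R x)))"
    by (simp add: commutator_bracket_def rota_baxter assms R_diff)
  \<comment> \<open>Regroup crosswise: \<open>mu (R x) y\<close> pairs with
    \<open>mu y (R x)\<close>, and \<open>mu x (R y)\<close> with \<open>mu (R y) x\<close>.\<close>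
  also have "(mu (R x) y + mu x (R y)) - (mu (R y) x + mu y (R x))
      = commutator_bracket mu (R x) y - commutator_bracket mu (R y) x"
    by (simp add: commutator_bracket_def)
  finally show ?thesis .
qed

end

theorem theorem4p1:
  fixes scale :: "'k::field_char_0 \<Rightarrow> 'a::ab_group_add \<Rightarrow> 'a"
    and mu star :: "'a \<Rightarrow> 'a \<Rightarrow> 'a"
    and alpha R :: "'a \<Rightarrow> 'a"
  assumes "rota_baxter_hom_lie_admissible scale mu alpha R 0"
    and "alpha \<circ> R = R \<circ> alpha"
    and "\<And>x y. star x y = mu (R x) y - mu y (R x)"
  shows "(\<forall>x y. star x y = commutator_bracket mu (R x) y) \<and> left_hom_prelie scale star alpha"
proof -
  interpret rota_baxter_hom_lie_admissible scale mu alpha R 0 by (fact assms(1))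
  let ?br = "commutator_bracket mu"
  have star: "star = (\<lambda>x y. ?br (R x) y)"
    using assms(3) by (simp add: fun_eq_iff commutator_bracket_def)
  have R_alpha: "R (alpha x) = alpha (R x)" for x
    using assms(2) by (simp add: fun_eq_iff)
  have "left_hom_prelie scale star alpha"
  proof (intro left_hom_prelie.intro hom_algebra.intro hom_algebra_axioms.intro
      left_hom_prelie_axioms.intro)
    show "vector_space scale"
      by (rule vector_space_axioms)
    show "Vector_Spaces.linear scale scale (\<lambda>x. star x y)" for y
      \<comment> \<open>In its first argument \<open>star\<close> is the bracket composed with
        \<open>R\<close>.\<close>
      using Vector_Spaces.linear_compose[OF R_linear commutator_bracket_linear_left]
      by (simp add: star comp_def)
    show "Vector_Spaces.linear scale scale (\<lambda>y. star x y)" for x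
      unfolding star by (rule commutator_bracket_linear_right)
    show "Vector_Spaces.linear scale scale alpha"
      by (rule alpha_linear)
    fix x y z
    \<comment> \<open>Antisymmetry of the inner bracket absorbs the minus sign, leaving two of the
      three cyclic terms of Hom-Jacobi.\<close>
    have "?br (alpha (R x)) (?br (R y) z) - ?br (alpha (R y)) (?br (R x) z)
        = ?br (alpha (R x)) (?br (R y) z) + ?br (alpha (R y)) (?br z (R x))"
      using commutator_bracket_minus_right[of "alpha (R y)" "?br (R x) z"]
      by (simp add: commutator_bracket_minus_swap[of mu "R x" z])
    also have "\<dots> = - ?br (alpha z) (?br (R x) (R y))"
      using hom_jacobi[of "R x" "R y" z] by (simp add: eq_neg_iff_add_eq_0)
    \<comment> \<open>Swapping the outer bracket removes the sign; \<open>refl\<close> discharges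
      \<open>weight = 0\<close>, as the interpreted weight is literally \<open>0\<close>.\<close>
    also have "\<dots> = ?br (R (?br (R x) y - ?br (R y) x)) (alpha z)"
      by (simp only: commutator_bracket_minus_swap commutator_bracket_R_R[OF refl])
    \<comment> \<open>Linearity separates the contributions of \<open>star x y\<close> and
      \<open>star y x\<close>.\<close>
    also have "\<dots> = ?br (R (?br (R x) y)) (alpha z) - ?br (R (?br (R y) x)) (alpha z)"
      by (simp add: commutator_bracket_diff_left R_diff)
    finally show "star (alpha x) (star y z) - star (alpha y) (star x z)
        = star (star x y) (alpha z) - star (star y x) (alpha z)"
      by (simp add: star R_alpha)
  qed
  then show ?thesis by (simp add: star)
qed

end
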